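(* Let $\mathcal N$ be a 1-input regular coupled cell network. Given a balanced colouring of the cells of $\mathcal N$ associated to a synchrony subspace for $\mathcal N$, the following hold: (i) Either the ring has all cells with the same colour, or its cells are coloured in a sequence of colours (with no two consecutive cells with the same colour) that is repeated sequentially, or each cell of the ring has a different colour. (ii) For each tail, when wrapped over the ring, one of the following happens: the colour of each cell of the tail coincides with the colour of the cell of the ring that it overlaps; or this happens only for the first cells of the tail and each of the subsequent cells has another different colour; or each cell of the tail has another different colour. (iii) Given two tails, suppose we start by wrapping each of them over the ring while the colour of each cell coincides with the colour of the cell of the ring that it overlaps. Then, fixing any two cells with the same colour, one from each of the tails, the sequence of (different) colours from the first cell of the tail that was not wrapped over the ring to the fixed cell is the same for the two tails.
   Context: A 1-input regular coupled cell network is a finite connected directed graph (self-loops allowed) in which all cells (vertices) are of one type, all edges are of one type, and every cell receives exactly one edge. Such a network is either a ring (a directed cycle, possibly a self-loop), or the coalescence of a ring with finitely many directed rooted trees whose edges point away from the root, the root of each tree being identified with a different cell of the ring. A leaf is a cell with no outgoing edge. A tail is the directed path from the root of a tree (a ring cell) to a leaf of that tree; in the claim the cells of the tail are those after the root, listed in order from the root to the leaf. Wrapping a tail over the ring: the cell of the tail at distance $k$ (number of edges) from the root $\rho$ overlaps the ring cell reached from $\rho$ after following $k$ edges of the ring. "Another different colour" means a colour that is not a colour of the ring and differs from the colours of the other cells of the tail. A synchrony subspace of $\mathcal N$ is a subspace $\{x:\ x_c=x_d\text{ whenever }c\bowtie d\}$ of the total phase space (the product of identical cell phase spaces $\mathbb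 R^k$), for an equivalence relation $\bowtie$ on cells, that is flow-invariant under all vector fields $\dot x_c=f(x_c;x_{i(c)})$ with $f$ smooth and $i(c)$ the tail of the unique edge into $c$. Equivalently, $\bowtie$ is balanced: colouring cells by $\bowtie$-class, cells with the same colour receive their input edge from cells of a same colour. This colouring is the balanced colouring associated to the synchrony subspace. *)

theory Defs
  imports
    "HOL-Analysis.Analysis"
    "Graph_Theory.Arc_Walk"
    "Graph_Theory.Digraph_Component"
begin

section \<open>The network, its ring and its tails\<close>

text \<open>Qualified because \<^const>\<open>Topological_Spaces.connected\<close> is also in scope.
  Connectedness is that of the underlying undirected graph and includes nonemptiness.\<close>

definition one_input_network :: "('v, 'e) pre_digraph \<Rightarrow> bool" where
  "one_input_network G \<longleftrightarrow>
     fin_digraph G \<and> Digraph_Component.connected G \<and> (\<forall>c\<in>verts G. in_degree G c = 1)"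

text \<open>The cell \<open>i(c)\<close> from which \<open>c\<close> receives its unique edge.\<close>

definition input_cell :: "('v, 'e) pre_digraph \<Rightarrow> 'v \<Rightarrow> 'v" where
  "input_cell G c = tail G (THE e. e \<in> arcs G \<and> head G e = c)"

text \<open>The ring is given by the list \<open>C\<close> of its edges, a directed cycle
  (\<^const>\<open>pre_digraph.cycle\<close> admits a single self-loop). In a 1-input network this
  cycle is unique up to the choice of the starting cell. The ring cells are listed in the
  direction of the edges.\<close>

definition ring_cells :: "('v, 'e) pre_digraph \<Rightarrow> 'e list \<Rightarrow> 'v list" where
  "ring_cells G C = map (tail G) C"

definition ring_next :: "('v, 'e) pre_digraph \<Rightarrow> 'e list \<Rightarrow> 'v \<Rightarrow> 'v" where
  "ring_next G C r = head G (THE e. e \<in> set C \<and> tail G e = r)"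

definition is_leaf :: "('v, 'e) pre_digraph \<Rightarrow> 'v \<Rightarrow> bool" where
  "is_leaf G c \<longleftrightarrow> c \<in> verts G \<and> out_degree G c = 0"

text \<open>A tail is a directed path \<open>p\<close> (list of edges) from a root \<open>r\<close> on the ring to a leaf.
  The path has to lie in the tree rooted at \<open>r\<close>, that is, it contains no ring cell other
  than \<open>r\<close>. Since \<open>r\<close> has an outgoing edge, \<open>p\<close> is never empty.\<close>

definition is_tail :: "('v, 'e) pre_digraph \<Rightarrow> 'e list \<Rightarrow> 'v \<Rightarrow> 'e list \<Rightarrow> bool" where
  "is_tail G C r p \<longleftrightarrow>
     r \<in> set (ring_cells G C) \<and>
     (\<exists>l. is_leaf G l \<and> pre_digraph.apath G r p l) \<and>
     set (tl (pre_digraph.awalk_verts G r p)) \<inter> set (ring_cells G C) = {}"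

text \<open>The cell at distance \<open>k\<close> from the root; the cells of the tail are those
  with \<open>k \<in> {1..length p}\<close>.\<close>

definition tail_cell :: "('v, 'e) pre_digraph \<Rightarrow> 'v \<Rightarrow> 'e list \<Rightarrow> nat \<Rightarrow> 'v" where
  "tail_cell G r p k = pre_digraph.awalk_verts G r p ! k"

definition overlapped_cell :: "('v, 'e) pre_digraph \<Rightarrow> 'e list \<Rightarrow> 'v \<Rightarrow> nat \<Rightarrow> 'v" where
  "overlapped_cell G C r k = (ring_next G C ^^ k) r"


section \<open>Synchrony subspaces\<close>

text \<open>\<open>C\<^sup>n\<close> maps: in finite dimension, continuity of all iterated directional
  derivatives up to order \<open>n\<close> of an everywhere differentiable map.\<close>

primrec C_n :: "nat \<Rightarrow> ('a::euclidean_space \<Rightarrow> 'b::euclidean_space) \<Rightarrow> bool" where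
  "C_n 0 f \<longleftrightarrow> continuous_on UNIV f"
| "C_n (Suc n) f \<longleftrightarrow>
     (\<exists>f'. (\<forall>x. (f has_derivative f' x) (at x)) \<and> (\<forall>v. C_n n (\<lambda>x. f' x v)))"

definition smooth :: "('a::euclidean_space \<Rightarrow> 'b::euclidean_space) \<Rightarrow> bool" where
  "smooth f \<longleftrightarrow> (\<forall>n. C_n n f)"

text \<open>Each cell has phase space \<open>real ^ 'k\<close>. Points of the total phase space are
  extensional functions, so that they are determined by their values on the cells.\<close>

definition total_phase_space :: "('v, 'e) pre_digraph \<Rightarrow> ('v \<Rightarrow> real ^ 'k) set" where
  "total_phase_space G = (verts G \<rightarrow>\<^sub>E UNIV)"

text \<open>\<open>x\<close> solves \<open>x\<^sub>c' = f (x\<^sub>c; x\<^sub>i\<^sub>(\<^sub>c\<^sub>))\<close> for all cells \<open>c\<close> on the time interval \<open>I\<close>.\<close>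

definition solves_network_on ::
  "('v, 'e) pre_digraph \<Rightarrow> ((real ^ 'k) \<times> (real ^ 'k) \<Rightarrow> real ^ 'k) \<Rightarrow> real set
     \<Rightarrow> (real \<Rightarrow> 'v \<Rightarrow> real ^ 'k) \<Rightarrow> bool" where
  "solves_network_on G f I x \<longleftrightarrow>
     (\<forall>t\<in>I. x t \<in> total_phase_space G \<and>
        (\<forall>c\<in>verts G.
          ((\<lambda>s. x s c) has_vector_derivative f (x t c, x t (input_cell G c))) (at t within I)))"

definition flow_invariant ::
  "('v, 'e) pre_digraph \<Rightarrow> ((real ^ 'k) \<times> (real ^ 'k) \<Rightarrow> real ^ 'k) \<Rightarrow>
     ('v \<Rightarrow> real ^ 'k) set \<Rightarrow> bool" where
  "flow_invariant G f S \<longleftrightarrow>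
     (\<forall>I x. is_interval I \<longrightarrow> 0 \<in> I \<longrightarrow> solves_network_on G f I x \<longrightarrow> x 0 \<in> S \<longrightarrow>
        (\<forall>t\<in>I. x t \<in> S))"

definition polydiagonal :: "('v, 'e) pre_digraph \<Rightarrow> 'v rel \<Rightarrow> ('v \<Rightarrow> real ^ 'k) set" where
  "polydiagonal G R = {x \<in> total_phase_space G. \<forall>(c, d)\<in>R. x c = x d}"

definition synchrony_subspace ::
  "('v, 'e) pre_digraph \<Rightarrow> ('v \<Rightarrow> real ^ 'k) set \<Rightarrow> bool" where
  "synchrony_subspace G S \<longleftrightarrow>
     (\<exists>R. equiv (verts G) R \<and> S = polydiagonal G R) \<and>
     (\<forall>f. smooth f \<longrightarrow> flow_invariant G f S)"

text \<open>\<open>col\<close> colours the cells by the classes of the equivalence relation that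
  defines \<open>S\<close>, i.e. \<open>S\<close> is the polydiagonal of the relation "same colour".
  When \<open>S\<close> is a synchrony subspace, this is its associated balanced colouring: balancedness
  (cells of the same colour have input cells of the same colour) is equivalent to the flow
  invariance of \<open>S\<close> and is therefore not imposed separately.\<close>

definition colouring_of_subspace ::
  "('v, 'e) pre_digraph \<Rightarrow> ('v \<Rightarrow> real ^ 'k) set \<Rightarrow> ('v \<Rightarrow> 'c) \<Rightarrow> bool" where
  "colouring_of_subspace G S col \<longleftrightarrow>
     S = polydiagonal G {(c, d). c \<in> verts G \<and> d \<in> verts G \<and> col c = col d}"


section \<open>Wrapping tails over the ring\<close>

definition overlap_coincides ::
  "('v, 'e) pre_digraph \<Rightarrow> 'e list \<Rightarrow> ('v \<Rightarrow> 'c) \<Rightarrow> 'v \<Rightarrow> 'e list \<Rightarrow> nat \<Rightarrow> bool" where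
  "overlap_coincides G C col r p k \<longleftrightarrow>
     col (tail_cell G r p k) = col (overlapped_cell G C r k)"

definition another_different_colour ::
  "('v, 'e) pre_digraph \<Rightarrow> 'e list \<Rightarrow> ('v \<Rightarrow> 'c) \<Rightarrow> 'v \<Rightarrow> 'e list \<Rightarrow> nat \<Rightarrow> bool" where
  "another_different_colour G C col r p k \<longleftrightarrow>
     col (tail_cell G r p k) \<notin> col ` set (ring_cells G C) \<and>
     (\<forall>j\<in>{1..length p}. j \<noteq> k \<longrightarrow> col (tail_cell G r p j) \<noteq> col (tail_cell G r p k))"

text \<open>The number of cells that get wrapped when the tail is wrapped over the ring from the
  root onwards for as long as the colours coincide.\<close>

definition wrapped_length ::
  "('v, 'e) pre_digraph \<Rightarrow> 'e list \<Rightarrow> ('v \<Rightarrow> 'c) \<Rightarrow> 'v \<Rightarrow> 'e list \<Rightarrow> nat" where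
  "wrapped_length G C col r p =
     (GREATEST m. m \<le> length p \<and> (\<forall>k\<in>{1..m}. overlap_coincides G C col r p k))"

text \<open>The colours from the first cell that was not wrapped to the cell at distance \<open>a\<close>;
  empty if the latter cell was wrapped.\<close>

definition unwrapped_colours ::
  "('v, 'e) pre_digraph \<Rightarrow> 'e list \<Rightarrow> ('v \<Rightarrow> 'c) \<Rightarrow> 'v \<Rightarrow> 'e list \<Rightarrow> nat \<Rightarrow> 'c list" where
  "unwrapped_colours G C col r p a =
     map (\<lambda>k. col (tail_cell G r p k)) [Suc (wrapped_length G C col r p)..<Suc a]"

end

theory Submission
  imports Defs
begin

text \<open>
  Write \<open>i(c)\<close> for the input cell of \<open>c\<close>. The proof has an analytic step, which turns
  invariance under all smooth vector fields into the combinatorial condition that cells of the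
  same colour have input cells of the same colour, and then works with iterates of \<open>i\<close> only.

  For the analytic step a single vector field suffices: \<open>f(u; v) = v\<close>, whose solutions are
  explicit power series whose coefficients are the initial values along backward orbits of
  \<open>i\<close>. If \<open>c\<close> and \<open>d\<close> have the same colour, invariance makes the two coordinates agree for all
  times, so their derivatives at time 0, which are the initial values at \<open>i(c)\<close> and \<open>i(d)\<close>,
  agree as well; starting from the indicator function of the colour of \<open>i(c)\<close> shows that
  \<open>i(d)\<close> has that colour too (\<open>balanced_if_synchrony_subspace\<close>).

  On the ring \<open>i\<close> is a cyclic permutation whose inverse is the successor. This inverse is itself
  a power of \<open>i\<close>, so equality of colours on the ring is preserved in both directions
  (\<open>col_funpow_ring_next\<close>). Hence one coincidence of colours on the ring makes the cyclic
  colour word invariant under a nontrivial rotation, which makes it a proper power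
  (\<open>ring_colour_pattern\<close>).

  On a tail, \<open>i\<close> moves one step towards the root. The decisive observation is
  \<open>overlap_coincides_iff_ring_colour\<close>: a tail cell whose colour occurs anywhere on the ring has
  the colour of the very cell that it overlaps. So the wrapped cells of a tail are those with a
  ring colour, and they form an initial segment. If two cells beyond their wrapped segments have
  the same colour, moving back along both tails simultaneously must reach the wrapped segments
  at the same moment, for otherwise a cell with a ring colour would share its colour with a cell
  without one (\<open>equal_colours_unwrapped_eq\<close>). Within one tail this says that unwrapped cells
  have distinct colours, and for two tails it says that the colour sequences from the first
  unwrapped cells agree.
\<close>

section \<open>Flow invariance forces balance\<close>

lemma C_n_const: "C_n n (\<lambda>x::'a::euclidean_space. c::'b::euclidean_space)"
proof (induction n arbitrary: c)
  case (Suc n)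
  show ?case
    unfolding C_n.simps by (rule exI[of _ "\<lambda>x v. 0"]) (simp add: Suc.IH)
qed simp

lemma smooth_bounded_linear:
  fixes f :: "'a::euclidean_space \<Rightarrow> 'b::euclidean_space"
  assumes "bounded_linear f"
  shows "smooth f"
  unfolding smooth_def
proof
  fix n
  show "C_n n f"
  proof (cases n)
    case 0
    then show ?thesis
      using assms by (simp add: linear_continuous_on)
  next
    case (Suc m)
    have "\<forall>x. (f has_derivative f) (at x)"
      using assms by (simp add: bounded_linear_imp_has_derivative)
    then show ?thesis
      unfolding Suc C_n.simps using C_n_const by (intro exI[of _ "\<lambda>x. f"]) auto
  qed
qed

text \<open>The solution, with initial values \<open>a\<close>, of \<open>x\<^sub>c' = x\<^sub>i\<^sub>(\<^sub>c\<^sub>)\<close>. It is the exponential of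
  the shift operator \<open>a \<mapsto> a \<circ> i\<close> applied to \<open>a\<close>, written out as a power series.\<close>

definition shift_solution :: "('v, 'e) pre_digraph \<Rightarrow> ('v \<Rightarrow> real) \<Rightarrow> real \<Rightarrow> 'v \<Rightarrow> real" where
  "shift_solution G a t c = (\<Sum>n. a ((input_cell G ^^ n) c) / fact n * t ^ n)"

lemma shift_solution_0: "shift_solution G a 0 c = a c"
  using powser_zero[of "\<lambda>n. a ((input_cell G ^^ n) c) / fact n"]
  by (simp add: shift_solution_def)

text \<open>Differentiating the exponential series shifts its coefficients by one, that is, replaces
  \<open>c\<close> by its input cell. Boundedness of \<open>a\<close> gives convergence by comparison with the exponential
  series.\<close>

lemma shift_solution_has_derivative:
  assumes bounded: "\<And>c. \<bar>a c\<bar> \<le> B"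
  shows "((\<lambda>t. shift_solution G a t c) has_real_derivative
           shift_solution G a t (input_cell G c)) (at t)"
proof -
  define u where "u n = a ((input_cell G ^^ n) c) / fact n" for n
  have "summable (\<lambda>n. u n * y ^ n)" for y
  proof (rule summable_comparison_test')
    show "summable (\<lambda>n. B * (inverse (fact n) * \<bar>y\<bar> ^ n))"
      by (intro summable_mult summable_exp)
    show "norm (u n * y ^ n) \<le> B * (inverse (fact n) * \<bar>y\<bar> ^ n)" if "n \<ge> 0" for n
    proof -
      have "norm (u n * y ^ n) = \<bar>a ((input_cell G ^^ n) c)\<bar> * (inverse (fact n) * \<bar>y\<bar> ^ n)"
        by (simp add: u_def abs_mult power_abs divide_inverse)
      also have "\<dots> \<le> B * (inverse (fact n) * \<bar>y\<bar> ^ n)"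
        by (intro mult_right_mono bounded) simp
      finally show ?thesis .
    qed
  qed
  then have "((\<lambda>t. \<Sum>n. u n * t ^ n) has_real_derivative (\<Sum>n. diffs u n * t ^ n)) (at t)"
    by (rule termdiffs_strong_converges_everywhere)
  moreover have "diffs u n = a ((input_cell G ^^ n) (input_cell G c)) / fact n" for n
    by (simp add: u_def diffs_def funpow_swap1 divide_simps del: of_nat_Suc)
  ultimately show ?thesis
    by (simp add: shift_solution_def u_def)
qed

text \<open>The vector field \<open>f(u; v) = v\<close> and one well chosen initial point detect a failure of
  balance at \<open>c\<close> and \<open>d\<close>.\<close>

lemma balanced_if_synchrony_subspace:
  fixes S :: "('v \<Rightarrow> real ^ 'k) set"
  assumes closed: "\<And>c. c \<in> verts G \<Longrightarrow> input_cell G c \<in> verts G"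
    and synchrony: "synchrony_subspace G S"
    and colouring: "colouring_of_subspace G S col"
    and cells: "c \<in> verts G" "d \<in> verts G" and same: "col c = col d"
  shows "col (input_cell G c) = col (input_cell G d)"
proof -
  \<comment> \<open>The indicator of the colour class of \<open>i(c)\<close> is constant on colour classes, so the initial
    point built from it lies in the subspace.\<close>
  define a :: "'v \<Rightarrow> real" where "a v = of_bool (col v = col (input_cell G c))" for v
  define x :: "real \<Rightarrow> 'v \<Rightarrow> real ^ 'k" where
    "x t = (\<lambda>v\<in>verts G. shift_solution G a t v *\<^sub>R 1)" for t
  have deriv: "((\<lambda>t. shift_solution G a t v) has_real_derivative
      shift_solution G a t (input_cell G v)) (at t)" for v t
    by (rule shift_solution_has_derivative[of a 1]) (simp add: a_def)
  have S: "S = polydiagonal G {(c, d). c \<in> verts G \<and> d \<in> verts G \<and> col c = col d}"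
    using colouring by (simp add: colouring_of_subspace_def)
  have "smooth (snd :: (real ^ 'k) \<times> (real ^ 'k) \<Rightarrow> real ^ 'k)"
    by (rule smooth_bounded_linear) (rule bounded_linear_snd)
  then have "flow_invariant G snd S"
    using synchrony by (simp add: synchrony_subspace_def)
  moreover have "solves_network_on G snd UNIV x"
    unfolding solves_network_on_def
  proof (intro ballI conjI)
    fix t and v assume v: "v \<in> verts G"
    have "((\<lambda>s. shift_solution G a s v *\<^sub>R (1 :: real ^ 'k)) has_vector_derivative
        shift_solution G a t (input_cell G v) *\<^sub>R 1) (at t)"
      using has_vector_derivative_scaleR[OF deriv has_vector_derivative_const] by simp
    then show "((\<lambda>s. x s v) has_vector_derivative snd (x t v, x t (input_cell G v)))
        (at t within UNIV)"
      using v closed by (simp add: x_def)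
  qed (simp add: x_def total_phase_space_def)
  moreover have "x 0 \<in> S"
    by (auto simp: S polydiagonal_def total_phase_space_def x_def shift_solution_0 a_def)
  ultimately have "x t \<in> S" for t
    unfolding flow_invariant_def by (metis UNIV_I is_interval_univ)
  then have "x t c = x t d" for t
    using cells same unfolding S polydiagonal_def by blast
  \<comment> \<open>Equal functions have equal derivatives, and these are the coordinates of the input cells.\<close>
  then have "(\<lambda>t. shift_solution G a t c) = (\<lambda>t. shift_solution G a t d)"
    using cells by (simp add: x_def fun_eq_iff)
  then have "shift_solution G a 0 (input_cell G c) = shift_solution G a 0 (input_cell G d)"
    using deriv[of c 0] deriv[of d 0] by (metis DERIV_unique)
  then show ?thesis
    by (simp add: shift_solution_0 a_def split: if_splits)
qed

section \<open>Ring and tails as orbits of the input map\<close>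

locale ringed_network =
  fixes G :: "('v, 'e) pre_digraph" and C :: "'e list"
  assumes network: "one_input_network G" and ring: "pre_digraph.cycle G C"
begin

sublocale fin_digraph G
  using network by (simp add: one_input_network_def)

abbreviation "inp \<equiv> input_cell G"
abbreviation "nxt \<equiv> ring_next G C"
abbreviation "R \<equiv> set (ring_cells G C)"

lemma input_cell_head:
  assumes "e \<in> arcs G"
  shows "inp (head G e) = tail G e"
proof -
  have "card (in_arcs G (head G e)) = 1"
    using network assms by (simp add: one_input_network_def in_degree_def)
  then obtain e' where "in_arcs G (head G e) = {e'}"
    by (rule card_1_singletonE)
  then have "e'' = e" if "e'' \<in> arcs G" "head G e'' = head G e" for e''
    using assms that in_in_arcs_conv by (metis singletonD)
  then have "(THE e'. e' \<in> arcs G \<and> head G e' = head G e) = e"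
    using assms by blast
  then show ?thesis
    by (simp add: input_cell_def)
qed

lemma input_cell_in_verts:
  assumes "c \<in> verts G"
  shows "inp c \<in> verts G"
proof -
  have "card (in_arcs G c) = 1"
    using network assms by (simp add: one_input_network_def in_degree_def)
  then obtain e where "e \<in> arcs G" "head G e = c"
    using in_in_arcs_conv by (metis card_1_singletonE singletonI)
  then show ?thesis
    using input_cell_head by auto
qed

text \<open>The head of each edge of a closed walk is the tail of the cyclically next edge. This
  transfers the distinctness that a cycle has by definition for its heads to the ring cells.\<close>

lemma heads_eq_rotate1_ring_cells: "map (head G) C = rotate1 (ring_cells G C)"
proof -
  obtain u where u: "awalk u C u" and "C \<noteq> []"
    using ring by (auto simp: cycle_def)
  then obtain e es where C: "C = e # es"
    by (cases C) auto
  have "cas u C u"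
    using u by (simp add: awalk_def)
  then have "tail G e # map (head G) C = map (tail G) C @ [head G (last C)]"
    using awalk_verts_conv[of u C] awalk_verts_conv'[of u C u] by (simp add: C)
  moreover have "head G (last C) = tail G e"
    using u awalk_verts_conv[of u C] awlast_of_awalk[OF u] 
    by (auto simp: C awalk_Cons_iff)
  ultimately show ?thesis
    by (simp add: C ring_cells_def)
qed

lemma distinct_ring_cells: "distinct (ring_cells G C)"
proof -
  obtain u where "awalk u C u" "distinct (tl (awalk_verts u C))" "C \<noteq> []"
    using ring by (auto simp: cycle_def)
  then have "distinct (map (head G) C)"
    using awalk_verts_conv'[of u C u] by (simp add: awalk_def)
  then show ?thesis
    by (simp add: heads_eq_rotate1_ring_cells)
qed

lemma ring_arcs: "set C \<subseteq> arcs G" and ring_nonempty: "0 < length C"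
  using ring by (auto simp: cycle_def awalk_def)

lemma length_ring_cells [simp]: "length (ring_cells G C) = length C"
  by (simp add: ring_cells_def)

lemma ring_in_verts: "R \<subseteq> verts G"
  using ring_arcs by (auto simp: ring_cells_def)

lemma ring_next_tail:
  assumes "e \<in> set C"
  shows "nxt (tail G e) = head G e"
proof -
  have "inj_on (tail G) (set C)"
    using distinct_ring_cells by (simp add: ring_cells_def distinct_map)
  then have "(THE e'. e' \<in> set C \<and> tail G e' = tail G e) = e"
    using assms by (auto dest: inj_onD)
  then show ?thesis
    by (simp add: ring_next_def)
qed

lemma ring_next_nth:
  assumes "j < length C"
  shows "nxt (ring_cells G C ! j) = ring_cells G C ! (Suc j mod length C)"
proof -
  have "nxt (ring_cells G C ! j) = map (head G) C ! j"
    using assms by (simp add: ring_cells_def ring_next_tail)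
  also have "\<dots> = ring_cells G C ! (Suc j mod length C)"
    using assms nth_rotate1[of j "ring_cells G C"] by (simp add: heads_eq_rotate1_ring_cells)
  finally show ?thesis .
qed

lemma funpow_ring_next_nth:
  assumes "j < length C"
  shows "(nxt ^^ k) (ring_cells G C ! j) = ring_cells G C ! ((j + k) mod length C)"
proof (induction k)
  case (Suc k)
  then show ?case
    using ring_next_nth[of "(j + k) mod length C"] ring_nonempty by (simp add: mod_Suc_eq)
qed (use assms in simp)

lemma ring_cell_nth:
  assumes "c \<in> R"
  obtains j where "j < length C" "c = ring_cells G C ! j"
  using assms by (metis in_set_conv_nth length_ring_cells)

lemma funpow_ring_next_in_ring: "c \<in> R \<Longrightarrow> (nxt ^^ k) c \<in> R"
  using ring_nonempty by (metis ring_cell_nth funpow_ring_next_nth length_ring_cells mod_less_divisor nth_mem)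

lemma funpow_ring_next_length: "c \<in> R \<Longrightarrow> (nxt ^^ length C) c = c"
  by (metis ring_cell_nth funpow_ring_next_nth mod_add_self2 mod_less)

lemma input_cell_ring_next:
  assumes "c \<in> R"
  shows "inp (nxt c) = c"
  using assms input_cell_head ring_arcs by (auto simp: ring_cells_def ring_next_tail)

lemma funpow_input_cell_ring_next: "c \<in> R \<Longrightarrow> (inp ^^ k) ((nxt ^^ k) c) = c"
proof (induction k)
  case (Suc k)
  have "(inp ^^ Suc k) ((nxt ^^ Suc k) c) = (inp ^^ k) (inp (nxt ((nxt ^^ k) c)))"
    by (simp add: funpow_swap1)
  with Suc show ?case
    by (simp add: input_cell_ring_next funpow_ring_next_in_ring)
qed simp

text \<open>Going once around the ring is the identity, so one step forward is the same as the
  remaining steps backward. Forward steps thereby become accessible to the balance condition,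
  which speaks of input cells only.\<close>

lemma ring_next_eq_funpow_input_cell:
  assumes "c \<in> R"
  shows "nxt c = (inp ^^ (length C - 1)) c"
proof -
  have "(nxt ^^ (length C - 1)) (nxt c) = (nxt ^^ Suc (length C - 1)) c"
    by (simp add: funpow_swap1)
  also have "\<dots> = c"
    using funpow_ring_next_length[OF assms] ring_nonempty by simp
  finally have "(nxt ^^ (length C - 1)) (nxt c) = c" .
  then show ?thesis
    using funpow_input_cell_ring_next[of "nxt c" "length C - 1"]
      funpow_ring_next_in_ring[OF assms, of 1] by simp
qed

text \<open>The preimage is found by going forward as well: \<open>k\<close> times \<open>n - 1\<close> steps followed by \<open>k\<close>
  more make \<open>k\<close> full turns, where \<open>n\<close> is the length of the ring.\<close>

lemma ring_next_funpow_surj: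
  assumes "d \<in> R"
  obtains c where "c \<in> R" "(nxt ^^ k) c = d"
proof
  let ?c = "(nxt ^^ (k * (length C - 1))) d"
  show "?c \<in> R"
    using assms by (rule funpow_ring_next_in_ring)
  have "k + k * (length C - 1) = k * length C"
    using ring_nonempty by (cases "length C") auto
  then have "(nxt ^^ k) ?c = ((nxt ^^ length C) ^^ k) d"
    by (metis funpow_add comp_apply funpow_mult mult.commute)
  also have "\<dots> = d"
    by (induction k) (simp_all add: assms funpow_ring_next_length)
  finally show "(nxt ^^ k) ?c = d" .
qed

lemma tail_cell_0:
  assumes "is_tail G C r p"
  shows "tail_cell G r p 0 = r"
proof -
  obtain l where "awalk r p l"
    using assms by (auto simp: is_tail_def apath_def)
  then show ?thesis
    using awhd_of_awalk by (simp add: tail_cell_def hd_conv_nth[symmetric])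
qed

lemma tail_cell_in_verts:
  assumes "is_tail G C r p" "k \<le> length p"
  shows "tail_cell G r p k \<in> verts G"
proof -
  obtain l where "awalk r p l"
    using assms by (auto simp: is_tail_def apath_def)
  then have "set (awalk_verts r p) \<subseteq> verts G"
    by auto
  then show ?thesis
    using assms(2) by (simp add: tail_cell_def length_awalk_verts subset_code(1))
qed

lemma input_cell_tail_cell:
  assumes "is_tail G C r p" "k < length p"
  shows "inp (tail_cell G r p (Suc k)) = tail_cell G r p k"
proof -
  obtain l where l: "awalk r p l"
    using assms by (auto simp: is_tail_def apath_def)
  have "p \<noteq> []" "p ! k \<in> arcs G"
    using assms(2) l by (auto simp: awalk_def)
  moreover have "tail_cell G r p (Suc k) = head G (p ! k)"
    using l assms(2) \<open>p \<noteq> []\<close> awalk_verts_conv'[of r p l] by (simp add: tail_cell_def awalk_def)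
  moreover have "tail_cell G r p k = tail G (p ! k)"
    using assms(2) \<open>p \<noteq> []\<close> by (simp add: tail_cell_def awalk_verts_conv nth_append)
  ultimately show ?thesis
    using input_cell_head by simp
qed

lemma funpow_input_cell_tail_cell:
  assumes "is_tail G C r p" "k \<le> length p" "j \<le> k"
  shows "(inp ^^ j) (tail_cell G r p k) = tail_cell G r p (k - j)"
  using assms(3)
proof (induction j)
  case (Suc j)
  have "inp (tail_cell G r p (Suc (k - Suc j))) = tail_cell G r p (k - Suc j)"
    using assms Suc.prems by (intro input_cell_tail_cell) auto
  moreover have "Suc (k - Suc j) = k - j"
    using Suc.prems by simp
  ultimately show ?case
    using Suc by simp
qed simp

end

section \<open>Balanced colourings of the ring\<close>

locale balanced_network = ringed_network G C
  for G :: "('v, 'e) pre_digraph" and C :: "'e list" +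
  fixes col :: "'v \<Rightarrow> 'c"
  assumes balanced:
    "\<And>c d. c \<in> verts G \<Longrightarrow> d \<in> verts G \<Longrightarrow> col c = col d \<Longrightarrow>
       col (input_cell G c) = col (input_cell G d)"
begin

lemma balanced_funpow:
  assumes "c \<in> verts G" "d \<in> verts G" "col c = col d"
  shows "col ((inp ^^ k) c) = col ((inp ^^ k) d)"
proof -
  have closed: "(inp ^^ j) v \<in> verts G" if "v \<in> verts G" for j v
    using that by (induction j) (simp_all add: input_cell_in_verts)
  show ?thesis
    by (induction k) (simp_all add: assms closed balanced)
qed

text \<open>Balance pushes an equality of colours backwards along the edges; on the ring it can also be
  pushed forwards, because a forward step is a power of the input map.\<close>

lemma col_funpow_ring_next:
  assumes "c \<in> R" "d \<in> R" "col c = col d"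
  shows "col ((nxt ^^ k) c) = col ((nxt ^^ k) d)"
proof (induction k)
  case (Suc k)
  let ?c = "(nxt ^^ k) c" and ?d = "(nxt ^^ k) d"
  have "?c \<in> R" "?d \<in> R"
    using assms by (auto intro: funpow_ring_next_in_ring)
  then show ?case
    using balanced_funpow[OF _ _ Suc.IH] ring_in_verts
    by (auto simp: ring_next_eq_funpow_input_cell)
qed (use assms in simp)

text \<open>A repeated colour at two positions of the ring makes the colour word invariant under rotation by
  their distance. Then the two pieces into which this rotation cuts the word commute, and
  commuting words are powers of a common word. If the repetition occurs at consecutive cells,
  all colours are the same.\<close>

lemma ring_colour_pattern:
  "(\<forall>c\<in>R. \<forall>d\<in>R. col c = col d) \<or>
   ((\<forall>c\<in>R. col c \<noteq> col (nxt c)) \<and>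
      (\<exists>s q. 2 \<le> q \<and> map col (ring_cells G C) = concat (replicate q s))) \<or>
   inj_on col R"
proof (cases "\<exists>c\<in>R. col c = col (nxt c)")
  case True
  then obtain c where c: "c \<in> R" "col c = col (nxt c)"
    by blast
  have orbit: "col ((nxt ^^ k) c) = col c" for k
  proof (induction k)
    case (Suc k)
    have "col ((nxt ^^ k) c) = col ((nxt ^^ k) (nxt c))"
      using c funpow_ring_next_in_ring[of c 1] by (intro col_funpow_ring_next) auto
    with Suc show ?case
      by (simp add: funpow_swap1)
  qed simp
  obtain j where j: "j < length C" "c = ring_cells G C ! j"
    using c(1) by (rule ring_cell_nth)
  have "col d = col c" if d: "d \<in> R" for d
  proof -
    obtain i where i: "i < length C" "d = ring_cells G C ! i"
      using d by (rule ring_cell_nth)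
    then have "(nxt ^^ (length C - j + i)) c = d"
      using j by (simp add: funpow_ring_next_nth)
    then show ?thesis
      using orbit by metis
  qed
  then show ?thesis
    by metis
next
  case no_repeat: False
  show ?thesis
  proof (cases "inj_on col R")
    case False
    let ?w = "map col (ring_cells G C)"
    obtain i j where ij: "i < j" "j < length C"
      and same: "col (ring_cells G C ! i) = col (ring_cells G C ! j)"
    proof -
      from False obtain c d where "c \<in> R" "d \<in> R" "c \<noteq> d" "col c = col d"
        by (auto simp: inj_on_def)
      then show thesis
        using that by (metis in_set_conv_nth length_ring_cells linorder_neqE_nat)
    qed
    have "rotate (j - i) ?w = ?w"
    proof (rule nth_equalityI)
      fix k assume "k < length (rotate (j - i) ?w)"
      then have k: "k < length C"
        by simp
      \<comment> \<open>Moving both cells forward by \<open>n - i + k\<close> steps, with \<open>n\<close> the length of the ring,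
        brings them to positions \<open>k\<close> and \<open>j - i + k\<close>.\<close>
      have "(j + (length C - i + k)) mod length C = (j - i + k) mod length C"
      proof -
        have "j + (length C - i + k) = (j - i + k) + length C"
          using ij by simp
        then show ?thesis
          by (metis mod_add_self2)
      qed
      moreover have "(i + (length C - i + k)) mod length C = k"
        using ij k by simp
      ultimately have "col (ring_cells G C ! k) = col (ring_cells G C ! ((j - i + k) mod length C))"
        using col_funpow_ring_next[OF _ _ same, of "length C - i + k"] ij
        by (simp add: funpow_ring_next_nth del: add_diff_assoc)
      then show "rotate (j - i) ?w ! k = ?w ! k"
        using k ring_nonempty by (simp add: nth_rotate)
    qed simp
    moreover have "rotate (j - i) ?w = drop (j - i) ?w @ take (j - i) ?w"
      using ij by (simp add: rotate_drop_take)
    ultimately have "take (j - i) ?w @ drop (j - i) ?w = drop (j - i) ?w @ take (j - i) ?w"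
      by (metis append_take_drop_id)
    moreover have "take (j - i) ?w \<noteq> []" "drop (j - i) ?w \<noteq> []"
      using ij ring_nonempty by (auto simp: ring_cells_def)
    ultimately have "\<exists>q s. q > 1 \<and> concat (replicate q s) = take (j - i) ?w @ drop (j - i) ?w"
      by (intro comm_append_is_replicate)
    then obtain q s where "q > 1" "concat (replicate q s) = ?w"
      by auto
    then have "\<exists>s q. 2 \<le> q \<and> ?w = concat (replicate q s)"
      by (metis Suc_1 Suc_leI One_nat_def)
    then show ?thesis
      using no_repeat by blast
  qed simp
qed

section \<open>Balanced colourings of the tails\<close>

lemma ring_colour_pull_back:
  assumes tail: "is_tail G C r p" and k: "k \<le> length p" and j: "j \<le> k"
    and d: "d \<in> R" "col (tail_cell G r p k) = col d"
  obtains c where "c \<in> R" "(nxt ^^ j) c = d" "col (tail_cell G r p (k - j)) = col c"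
proof -
  obtain c where c: "c \<in> R" "(nxt ^^ j) c = d"
    using ring_next_funpow_surj[OF d(1)] .
  have "col ((inp ^^ j) (tail_cell G r p k)) = col ((inp ^^ j) d)"
    using tail_cell_in_verts[OF tail k] d ring_in_verts by (intro balanced_funpow) auto
  then have "col (tail_cell G r p (k - j)) = col c"
    using c j funpow_input_cell_tail_cell[OF tail k] funpow_input_cell_ring_next by metis
  with c show thesis
    by (rule that)
qed

text \<open>Suppose that the cell at distance \<open>k\<close> from the root has the colour of a ring cell \<open>d\<close>. Moving
  both back by \<open>k\<close> steps shows that the root has the colour of the ring cell \<open>k\<close> steps
  before \<open>d\<close>; moving forward along the ring from there shows that \<open>d\<close> has the colour of the
  overlapped cell.\<close>

lemma overlap_coincides_iff_ring_colour:
  assumes tail: "is_tail G C r p" and k: "k \<le> length p"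
  shows "overlap_coincides G C col r p k \<longleftrightarrow> col (tail_cell G r p k) \<in> col ` R"
proof
  have r: "r \<in> R"
    using tail by (simp add: is_tail_def)
  show "col (tail_cell G r p k) \<in> col ` R" if "overlap_coincides G C col r p k"
    using that r funpow_ring_next_in_ring[OF r]
    by (simp add: overlap_coincides_def overlapped_cell_def)
  show "overlap_coincides G C col r p k" if ring_colour: "col (tail_cell G r p k) \<in> col ` R"
  proof -
    obtain d where d: "d \<in> R" "col (tail_cell G r p k) = col d"
      using ring_colour by blast
    obtain c where c: "c \<in> R" "(nxt ^^ k) c = d" "col (tail_cell G r p (k - k)) = col c"
      using ring_colour_pull_back[OF tail k order_refl d] .
    then have "col r = col c"
      by (simp add: tail_cell_0[OF tail])
    then have "col ((nxt ^^ k) r) = col d"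
      using col_funpow_ring_next[of r c k] r c by simp
    then show ?thesis
      using d by (simp add: overlap_coincides_def overlapped_cell_def)
  qed
qed

text \<open>Having a ring colour passes from a tail cell to all cells between it and the root,
  because the input cell of a ring cell is a ring cell. So the greatest initial
  segment on which the colours coincide contains every cell with a ring colour.\<close>

lemma ring_colour_iff_le_wrapped_length:
  assumes tail: "is_tail G C r p" and k: "k \<le> length p"
  shows "col (tail_cell G r p k) \<in> col ` R \<longleftrightarrow> k \<le> wrapped_length G C col r p"
    (is "_ \<longleftrightarrow> _ \<le> ?m")
proof -
  let ?P = "\<lambda>m. m \<le> length p \<and> (\<forall>k\<in>{1..m}. overlap_coincides G C col r p k)"
  have r: "col (tail_cell G r p 0) \<in> col ` R"
    using tail tail_cell_0[OF tail] by (simp add: is_tail_def)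
  have m: "?P ?m"
    unfolding wrapped_length_def by (rule GreatestI_nat[of ?P 0 "length p"]) auto
  show ?thesis
  proof
    assume "k \<le> ?m"
    then show "col (tail_cell G r p k) \<in> col ` R"
      using m r k overlap_coincides_iff_ring_colour[OF tail, of k] by (cases "k = 0") auto
  next
    assume "col (tail_cell G r p k) \<in> col ` R"
    then obtain d where d: "d \<in> R" "col (tail_cell G r p k) = col d"
      by blast
    have "overlap_coincides G C col r p j" if "j \<in> {1..k}" for j
    proof -
      obtain c where "c \<in> R" "col (tail_cell G r p (k - (k - j))) = col c"
        using ring_colour_pull_back[OF tail k diff_le_self d] .
      then show ?thesis
        using that k overlap_coincides_iff_ring_colour[OF tail, of j] by simp
    qed
    then have "?P k"
      using k by simp
    then show "k \<le> ?m"
      unfolding wrapped_length_def by (rule Greatest_le_nat[of ?P k "length p"]) auto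
  qed
qed

lemma wrapped_length_le:
  assumes "is_tail G C r p"
  shows "wrapped_length G C col r p \<le> length p"
  unfolding wrapped_length_def
  using GreatestI_nat[of "\<lambda>m. m \<le> length p \<and> (\<forall>k\<in>{1..m}. overlap_coincides G C col r p k)" 0]
  by auto

lemma equal_colours_wrapped_iff:
  assumes "is_tail G C r p" "is_tail G C r' p'"
    and "a \<le> length p" "b \<le> length p'"
    and "col (tail_cell G r p a) = col (tail_cell G r' p' b)"
  shows "a \<le> wrapped_length G C col r p \<longleftrightarrow> b \<le> wrapped_length G C col r' p'"
  using assms ring_colour_iff_le_wrapped_length by metis

lemma equal_colours_pull_back:
  assumes "is_tail G C r p" "is_tail G C r' p'"
    and "a \<le> length p" "b \<le> length p'"
    and "col (tail_cell G r p a) = col (tail_cell G r' p' b)"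
    and "j \<le> a" "j \<le> b"
  shows "col (tail_cell G r p (a - j)) = col (tail_cell G r' p' (b - j))"
  using balanced_funpow[OF tail_cell_in_verts tail_cell_in_verts, of r p a r' p' b j] assms
  by (simp add: funpow_input_cell_tail_cell)

text \<open>Otherwise, moving both cells back until the second one enters its wrapped segment would
  leave the first one outside of its own, with equal colours of which only one is a ring colour.\<close>

lemma equal_colours_unwrapped_le:
  assumes tails: "is_tail G C r p" "is_tail G C r' p'"
    and cells: "a \<le> length p" "b \<le> length p'"
    and same: "col (tail_cell G r p a) = col (tail_cell G r' p' b)"
    and unwrapped: "wrapped_length G C col r p < a"
  shows "a - wrapped_length G C col r p \<le> b - wrapped_length G C col r' p'"
proof -
  let ?m = "wrapped_length G C col r p" and ?m' = "wrapped_length G C col r' p'"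
  have "?m' < b"
    using equal_colours_wrapped_iff[OF tails cells same] unwrapped by simp
  have "col (tail_cell G r p (a - (b - ?m'))) = col (tail_cell G r' p' ?m')"
    if "b - ?m' \<le> a"
    using equal_colours_pull_back[OF tails cells same that] \<open>?m' < b\<close> by simp
  moreover have "?m' \<le> length p'"
    using tails by (intro wrapped_length_le)
  ultimately have "a - (b - ?m') \<le> ?m" if "b - ?m' \<le> a"
    using that cells equal_colours_wrapped_iff[OF tails, of "a - (b - ?m')" ?m'] by simp
  then show ?thesis
    by linarith
qed

lemma equal_colours_unwrapped_eq:
  assumes tails: "is_tail G C r p" "is_tail G C r' p'"
    and cells: "a \<le> length p" "b \<le> length p'"
    and same: "col (tail_cell G r p a) = col (tail_cell G r' p' b)"
    and unwrapped: "wrapped_length G C col r p < a"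
  shows "a - wrapped_length G C col r p = b - wrapped_length G C col r' p'"
proof (rule antisym)
  show "a - wrapped_length G C col r p \<le> b - wrapped_length G C col r' p'"
    using assms by (rule equal_colours_unwrapped_le)
  have "wrapped_length G C col r' p' < b"
    using equal_colours_wrapped_iff[OF tails cells same] unwrapped by simp
  then show "b - wrapped_length G C col r' p' \<le> a - wrapped_length G C col r p"
    using tails cells same by (intro equal_colours_unwrapped_le) auto
qed

text \<open>This is \<open>equal_colours_unwrapped_eq\<close> for a tail compared with itself.\<close>

lemma unwrapped_cells_have_distinct_colours:
  assumes tail: "is_tail G C r p" and cells: "a \<le> length p" "b \<le> length p"
    and unwrapped: "wrapped_length G C col r p < a"
    and same: "col (tail_cell G r p a) = col (tail_cell G r p b)"
  shows "a = b"
proof -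
  have "wrapped_length G C col r p < b"
    using equal_colours_wrapped_iff[OF tail tail cells same] unwrapped by simp
  then show ?thesis
    using equal_colours_unwrapped_eq[OF tail tail cells same unwrapped] unwrapped by linarith
qed

lemma unwrapped_another_different_colour:
  assumes tail: "is_tail G C r p" and k: "k \<le> length p"
    and unwrapped: "wrapped_length G C col r p < k"
  shows "another_different_colour G C col r p k"
  unfolding another_different_colour_def
proof (intro conjI ballI impI)
  show "col (tail_cell G r p k) \<notin> col ` R"
    using ring_colour_iff_le_wrapped_length[OF tail k] unwrapped by simp
  show "col (tail_cell G r p j) \<noteq> col (tail_cell G r p k)"
    if "j \<in> {1..length p}" "j \<noteq> k" for j
    using unwrapped_cells_have_distinct_colours[OF tail k, of j] unwrapped that by auto
qed

lemma tail_colour_pattern: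
  assumes tail: "is_tail G C r p"
  shows "(\<forall>k\<in>{1..length p}. overlap_coincides G C col r p k) \<or>
    (\<exists>m\<in>{1..<length p}.
       (\<forall>k\<in>{1..m}. overlap_coincides G C col r p k) \<and>
       (\<forall>k\<in>{Suc m..length p}. another_different_colour G C col r p k)) \<or>
    (\<forall>k\<in>{1..length p}. another_different_colour G C col r p k)"
proof -
  let ?m = "wrapped_length G C col r p"
  have wrapped: "overlap_coincides G C col r p k" if "k \<le> ?m" for k
    using that wrapped_length_le[OF tail] overlap_coincides_iff_ring_colour[OF tail, of k]
      ring_colour_iff_le_wrapped_length[OF tail, of k] by simp
  have unwrapped: "\<forall>k\<in>{Suc ?m..length p}. another_different_colour G C col r p k"
    using unwrapped_another_different_colour[OF tail] by simp
  consider "?m = 0" | "?m = length p" | "?m \<in> {1..<length p}"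
    using wrapped_length_le[OF tail] by fastforce
  then show ?thesis
  proof cases
    case 1
    then show ?thesis
      using unwrapped by simp
  next
    case 2
    then show ?thesis
      using wrapped by simp
  next
    case 3
    then show ?thesis
      using wrapped unwrapped by (metis atLeastAtMost_iff)
  qed
qed

lemma tails_with_equal_colours:
  assumes tails: "is_tail G C r p" "is_tail G C r' p'"
    and cells: "a \<le> length p" "b \<le> length p'"
    and same: "col (tail_cell G r p a) = col (tail_cell G r' p' b)"
  shows "distinct (unwrapped_colours G C col r p a)"
    and "unwrapped_colours G C col r p a = unwrapped_colours G C col r' p' b"
proof -
  let ?m = "wrapped_length G C col r p" and ?m' = "wrapped_length G C col r' p'"
  show "distinct (unwrapped_colours G C col r p a)"
    unfolding unwrapped_colours_def distinct_map
    using cells unwrapped_cells_have_distinct_colours[OF tails(1)]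
    by (auto intro!: inj_onI simp del: upt_Suc)
  show "unwrapped_colours G C col r p a = unwrapped_colours G C col r' p' b"
  proof (cases "a \<le> ?m")
    case True
    then have "b \<le> ?m'"
      using equal_colours_wrapped_iff[OF tails cells same] by simp
    with True show ?thesis
      by (simp add: unwrapped_colours_def)
  next
    case False
    then have a: "?m < a" and b: "?m' < b"
      using equal_colours_wrapped_iff[OF tails cells same] by simp_all
    have eq: "a - ?m = b - ?m'"
      using a by (rule equal_colours_unwrapped_eq[OF tails cells same])
    show ?thesis
    proof (rule nth_equalityI)
      show "length (unwrapped_colours G C col r p a) = length (unwrapped_colours G C col r' p' b)"
        using eq by (simp add: unwrapped_colours_def del: upt_Suc)
      fix i assume "i < length (unwrapped_colours G C col r p a)"
      then have i: "i < a - ?m"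
        by (simp add: unwrapped_colours_def del: upt_Suc)
      \<comment> \<open>The cells at position \<open>i\<close> lie equally many steps before the two fixed cells.\<close>
      have "col (tail_cell G r p (a - (a - ?m - Suc i))) =
          col (tail_cell G r' p' (b - (a - ?m - Suc i)))"
        using i eq by (intro equal_colours_pull_back[OF tails cells same]) auto
      moreover have "a - (a - ?m - Suc i) = Suc ?m + i" "b - (a - ?m - Suc i) = Suc ?m' + i"
        using i eq a b by linarith+
      ultimately show "unwrapped_colours G C col r p a ! i = unwrapped_colours G C col r' p' b ! i"
        using i eq by (simp add: unwrapped_colours_def del: upt_Suc)
    qed
  qed
qed

end

theorem corollary4p8:
  fixes G :: "('v, 'e) pre_digraph"
    and C :: "'e list"
    and S :: "('v \<Rightarrow> real ^ 'k) set"
    and col :: "'v \<Rightarrow> 'c"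
  assumes network: "one_input_network G"
    and ring: "pre_digraph.cycle G C"
    and synchrony: "synchrony_subspace G S"
    and colouring: "colouring_of_subspace G S col"
  shows
    \<comment> \<open>(i)\<close>
    "((\<forall>c\<in>set (ring_cells G C). \<forall>d\<in>set (ring_cells G C). col c = col d) \<or>
      ((\<forall>c\<in>set (ring_cells G C). col c \<noteq> col (ring_next G C c)) \<and>
         (\<exists>s q. 2 \<le> q \<and> map col (ring_cells G C) = concat (replicate q s))) \<or>
      inj_on col (set (ring_cells G C))) \<and>
     \<comment> \<open>(ii)\<close>
     (\<forall>r p. is_tail G C r p \<longrightarrow>
       (\<forall>k\<in>{1..length p}. overlap_coincides G C col r p k) \<or>
       (\<exists>m\<in>{1..<length p}.
          (\<forall>k\<in>{1..m}. overlap_coincides G C col r p k) \<and>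
          (\<forall>k\<in>{Suc m..length p}. another_different_colour G C col r p k)) \<or>
       (\<forall>k\<in>{1..length p}. another_different_colour G C col r p k)) \<and>
     \<comment> \<open>(iii)\<close>
     (\<forall>r p r' p'. is_tail G C r p \<longrightarrow> is_tail G C r' p' \<longrightarrow>
       (\<forall>a\<in>{1..length p}. \<forall>b\<in>{1..length p'}.
          col (tail_cell G r p a) = col (tail_cell G r' p' b) \<longrightarrow>
          distinct (unwrapped_colours G C col r p a) \<and>
          unwrapped_colours G C col r p a = unwrapped_colours G C col r' p' b))"
proof -
  interpret ringed_network G C
    using network ring by unfold_locales
  interpret balanced_network G C col
    using balanced_if_synchrony_subspace[OF input_cell_in_verts synchrony colouring]
    by unfold_locales
  show ?thesis
    (is "_ \<and> ?tails \<and> ?pairs")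
  proof (intro conjI)
    show ?tails
      using tail_colour_pattern by blast
    show ?pairs
      by (intro allI impI ballI conjI tails_with_equal_colours) simp_all
  qed (rule ring_colour_pattern)
qed

end
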